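(* The emptiness problem for register set automata with removal and register emptiness test is undecidable.
   Context: Fix a finite nonempty alphabet $\Sigma$ and an infinite data domain $\mathbb{D}$. A register set automaton with removal and register emptiness test is a tuple $(Q,R,\Delta,I,F)$ with $Q$ finite states, $R$ finite registers, $I,F\subseteq Q$, and transitions $q\xrightarrow{a\mid G^{\in},G^{\notin},G^{\emptyset},Rem,up}s$ with $a\in\Sigma$, $G^{\in},G^{\notin},G^{\emptyset},Rem\subseteq R$, and $up\colon R\to 2^{R\cup\{\mathit{in}\}}$. Configurations are $(q,f)$ with $f\colon R\to 2^{\mathbb{D}}$; initial ones have $q\in I$ and all registers empty. A step over $(a,d)\in\Sigma\times\mathbb{D}$ is possible iff $d\in f(r)$ for all $r\in G^{\in}$, $d\notin f(r)$ for all $r\in G^{\notin}$, and $f(r)=\emptyset$ for all $r\in G^{\emptyset}$; the registers are then updated by removing $d$ from each register in $Rem$ and setting each register $r$ to $\bigcup\{x\mid x\in up(r)\}$ (the union of the contents of the registers in $up(r)$, together with $d$ if $\mathit{in}\in up(r)$). The language is the set of words in $(\Sigma\times\mathbb{D})^*$ with a run from an initial configuration ending in $F$; the emptiness problem asks whether this language is empty. *)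

theory Defs
  imports Main "HOL-Library.Nat_Bijection"
begin

section \<open>Register set automata with removal and register emptiness test\<close>

(* An element of R \<union> {in}. *)
datatype 'r source = Reg 'r | In

record ('q, 'r, 'a) transition =
  src :: 'q
  letter :: 'a
  guard_in :: "'r set"
  guard_notin :: "'r set"
  guard_empty :: "'r set"
  removal :: "'r set"
  update :: "'r \<Rightarrow> 'r source set"
  tgt :: 'q

record ('q, 'r, 'a) rsa =
  states :: "'q set"
  regs :: "'r set"
  transitions :: "('q, 'r, 'a) transition set"
  initial :: "'q set"
  final :: "'q set"

(* A function on R is represented by a total function that takes the value {} outside R;
   this applies to the update of a transition here and to register contents below. *)
definition transition_wf :: "'q set \<Rightarrow> 'r set \<Rightarrow> ('q, 'r, 'a) transition \<Rightarrow> bool" where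
  "transition_wf Q R t \<longleftrightarrow>
     src t \<in> Q \<and> tgt t \<in> Q \<and>
     guard_in t \<subseteq> R \<and> guard_notin t \<subseteq> R \<and> guard_empty t \<subseteq> R \<and> removal t \<subseteq> R \<and>
     (\<forall>r\<in>R. update t r \<subseteq> insert In (Reg ` R)) \<and> (\<forall>r. r \<notin> R \<longrightarrow> update t r = {})"

definition rsa_wf :: "('q, 'r, 'a) rsa \<Rightarrow> bool" where
  "rsa_wf A \<longleftrightarrow>
     finite (states A) \<and> finite (regs A) \<and> finite (transitions A) \<and>
     initial A \<subseteq> states A \<and> final A \<subseteq> states A \<and>
     (\<forall>t\<in>transitions A. transition_wf (states A) (regs A) t)"

definition enabled :: "('q, 'r, 'a) transition \<Rightarrow> ('r \<Rightarrow> 'd set) \<Rightarrow> 'd \<Rightarrow> bool" where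
  "enabled t f d \<longleftrightarrow>
     (\<forall>r\<in>guard_in t. d \<in> f r) \<and> (\<forall>r\<in>guard_notin t. d \<notin> f r) \<and> (\<forall>r\<in>guard_empty t. f r = {})"

definition remove_datum :: "'r set \<Rightarrow> 'd \<Rightarrow> ('r \<Rightarrow> 'd set) \<Rightarrow> 'r \<Rightarrow> 'd set" where
  "remove_datum S d f r = (if r \<in> S then f r - {d} else f r)"

fun content :: "('r \<Rightarrow> 'd set) \<Rightarrow> 'd \<Rightarrow> 'r source \<Rightarrow> 'd set" where
  "content f d (Reg r) = f r"
| "content f d In = {d}"

(* The removal comes first; the update then reads the reduced register contents. *)
definition next_regs :: "('q, 'r, 'a) transition \<Rightarrow> ('r \<Rightarrow> 'd set) \<Rightarrow> 'd \<Rightarrow> 'r \<Rightarrow> 'd set" where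
  "next_regs t f d r = (\<Union>x\<in>update t r. content (remove_datum (removal t) d f) d x)"

inductive step ::
  "('q, 'r, 'a) rsa \<Rightarrow> 'q \<times> ('r \<Rightarrow> 'd set) \<Rightarrow> 'a \<times> 'd \<Rightarrow> 'q \<times> ('r \<Rightarrow> 'd set) \<Rightarrow> bool"
  for A where
  "t \<in> transitions A \<Longrightarrow> enabled t f d \<Longrightarrow>
   step A (src t, f) (letter t, d) (tgt t, next_regs t f d)"

inductive run ::
  "('q, 'r, 'a) rsa \<Rightarrow> 'q \<times> ('r \<Rightarrow> 'd set) \<Rightarrow> ('a \<times> 'd) list \<Rightarrow> 'q \<times> ('r \<Rightarrow> 'd set) \<Rightarrow> bool"
  for A where
  run_Nil: "run A c [] c"
| run_Cons: "step A c x c' \<Longrightarrow> run A c' w c'' \<Longrightarrow> run A c (x # w) c''"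

definition language :: "('q, 'r, 'a) rsa \<Rightarrow> ('a \<times> 'd) list set" where
  "language A = {w. \<exists>q\<in>initial A. \<exists>s\<in>final A. \<exists>f. run A (q, \<lambda>_. {}) w (s, f)}"


section \<open>Partial recursive functions and decidability\<close>

(* Tuples of arguments are lists. A term of intended arity k denotes a k-ary partial function;
   its value on lists of another length plays no role. The first argument of a primitive
   recursion is the recursion argument, and minimisation ranges over the first argument. *)
datatype recf =
    Zero
  | Succ
  | Proj nat
  | Comp recf "recf list"
  | Prim recf recf
  | Mu recf

fun eval :: "recf \<Rightarrow> nat list \<Rightarrow> nat option" where
  "eval Zero xs = Some 0"
| "eval Succ xs = (case xs of [] \<Rightarrow> None | x # _ \<Rightarrow> Some (Suc x))"
| "eval (Proj i) xs = (if i < length xs then Some (xs ! i) else None)"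
| "eval (Comp f gs) xs =
     (if \<forall>g\<in>set gs. eval g xs \<noteq> None then eval f (map (\<lambda>g. the (eval g xs)) gs) else None)"
| "eval (Prim f g) xs =
     (case xs of [] \<Rightarrow> None
      | n # ys \<Rightarrow> rec_nat (eval f ys) (\<lambda>m v. Option.bind v (\<lambda>y. eval g (m # y # ys))) n)"
| "eval (Mu f) xs =
     (if \<exists>n. eval f (n # xs) = Some 0 \<and> (\<forall>i<n. eval f (i # xs) \<noteq> None)
      then Some (LEAST n. eval f (n # xs) = Some 0) else None)"

(* The problem with instances X, given to the algorithm through their codes enc, and
   yes-instances {x \<in> X. P x}. Nothing is required of the algorithm on numbers that are not
   codes of instances. *)
definition decidable :: "('i \<Rightarrow> nat) \<Rightarrow> 'i set \<Rightarrow> ('i \<Rightarrow> bool) \<Rightarrow> bool" where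
  "decidable enc X P \<longleftrightarrow> (\<exists>f. \<forall>x\<in>X. eval f [enc x] = Some (if P x then 1 else 0))"


section \<open>Codes of automata\<close>

(* Instances of a decision problem are finite objects, so their states and registers are taken
   to be natural numbers. The numbering la of the letters is a parameter. *)

fun source_code :: "nat source \<Rightarrow> nat" where
  "source_code In = 0"
| "source_code (Reg r) = Suc r"

definition update_code :: "nat set \<Rightarrow> (nat \<Rightarrow> nat source set) \<Rightarrow> nat" where
  "update_code R u = set_encode ((\<lambda>r. prod_encode (r, set_encode (source_code ` u r))) ` R)"

definition transition_code ::
  "('a \<Rightarrow> nat) \<Rightarrow> nat set \<Rightarrow> (nat, nat, 'a) transition \<Rightarrow> nat" where
  "transition_code la R t = list_encode
     [src t, la (letter t), set_encode (guard_in t), set_encode (guard_notin t),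
      set_encode (guard_empty t), set_encode (removal t), update_code R (update t), tgt t]"

definition rsa_code :: "('a \<Rightarrow> nat) \<Rightarrow> (nat, nat, 'a) rsa \<Rightarrow> nat" where
  "rsa_code la A = list_encode
     [set_encode (states A), set_encode (regs A),
      set_encode (transition_code la (regs A) ` transitions A),
      set_encode (initial A), set_encode (final A)]"

lemma inj_source_code: "inj source_code"
proof (rule injI)
  fix x y show "source_code x = source_code y \<Longrightarrow> x = y" by (cases x; cases y) auto
qed

lemma update_code_inject:
  assumes "finite R" "update_code R u = update_code R v"
    and u: "\<forall>r\<in>R. u r \<subseteq> insert In (Reg ` R)" "\<forall>r. r \<notin> R \<longrightarrow> u r = {}"
    and v: "\<forall>r\<in>R. v r \<subseteq> insert In (Reg ` R)" "\<forall>r. r \<notin> R \<longrightarrow> v r = {}"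
  shows "u = v"
proof
  fix r
  have fin: "finite (u r)" "finite (v r)" if "r \<in> R" for r
    using that u(1) v(1) assms(1) by (meson finite_imageI finite_insert finite_subset)+
  have eq: "(\<lambda>r. prod_encode (r, set_encode (source_code ` u r))) ` R
      = (\<lambda>r. prod_encode (r, set_encode (source_code ` v r))) ` R"
    using assms(1,2) by (simp add: update_code_def set_encode_eq)
  show "u r = v r"
  proof (cases "r \<in> R")
    case True
    then have "prod_encode (r, set_encode (source_code ` u r))
        \<in> (\<lambda>r. prod_encode (r, set_encode (source_code ` v r))) ` R"
      using eq by blast
    then have "set_encode (source_code ` u r) = set_encode (source_code ` v r)"
      by (auto simp: prod_encode_eq)
    then have "source_code ` u r = source_code ` v r"
      using fin[OF True] by (simp add: set_encode_eq)
    then show ?thesis by (simp add: inj_image_eq_iff[OF inj_source_code])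
  next
    case False
    then show ?thesis using u(2) v(2) by simp
  qed
qed

lemma transition_code_inj_on:
  assumes "inj la" "finite R"
  shows "inj_on (transition_code la R) {t. transition_wf Q R t}"
proof (rule inj_onI)
  fix t t' :: "(nat, nat, 'a) transition"
  assume t: "t \<in> {t. transition_wf Q R t}" and t': "t' \<in> {t. transition_wf Q R t}"
    and eq: "transition_code la R t = transition_code la R t'"
  have sub: "finite S" if "S \<subseteq> R" for S using that assms(2) finite_subset by blast
  have "update t = update t'"
    using eq t t' assms(2)
    by (intro update_code_inject[of R]) (auto simp: transition_code_def transition_wf_def)
  then show "t = t'"
    using eq t t' assms(1)
    by (intro transition.equality)
       (auto simp: transition_code_def transition_wf_def inj_eq set_encode_eq sub)
qed

(* The code determines the automaton. *)
lemma rsa_code_inj_on: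
  assumes "inj la"
  shows "inj_on (rsa_code la) {A. rsa_wf A}"
proof (rule inj_onI)
  fix A B :: "(nat, nat, 'a) rsa"
  assume A: "A \<in> {A. rsa_wf A}" and B: "B \<in> {A. rsa_wf A}"
    and eq: "rsa_code la A = rsa_code la B"
  have fin: "finite (states A)" "finite (states B)" "finite (regs A)" "finite (regs B)"
    "finite (transitions A)" "finite (transitions B)" "finite (initial A)" "finite (initial B)"
    "finite (final A)" "finite (final B)"
    using A B by (auto simp: rsa_wf_def intro: finite_subset)
  have e: "states A = states B" "regs A = regs B" "initial A = initial B" "final A = final B"
    and im: "transition_code la (regs A) ` transitions A
           = transition_code la (regs A) ` transitions B"
    using eq fin by (auto simp: rsa_code_def set_encode_eq)
  have "transitions A = transitions B"
    using im inj_on_image_eq_iff[OF transition_code_inj_on[OF assms fin(3), of "states A"]]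
      A B e by (metis (no_types, lifting) mem_Collect_eq rsa_wf_def subsetI)
  with e show "A = B" by (intro rsa.equality) auto
qed

end

theory Submission
  imports Defs
begin

text \<open>A register serves as a counter whose value is its number of elements: reading a datum not in
  the register increments it, removing a datum in it decrements it, and the emptiness test is the
  zero test. As the domain is infinite, a new datum is always available. So the automata simulate
  counter programs, and these compute all partial recursive functions.

  Undecidability follows by diagonalisation. Suppose \<open>D\<close> decides emptiness. An automaton that
  first loads two numbers \<open>p\<close> and \<open>t\<close> through chains of increments and then runs a fixed
  program has a code that is a recursive function of \<open>p\<close> and \<open>t\<close>, if \<open>p\<close> bounds the states and
  registers of the program and \<open>t\<close> codes its transitions. Take the program that computes this code,
  applies \<open>D\<close> to it and accepts iff the result is 1: the language of the automaton is nonempty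
  iff \<open>D\<close> declares it empty.\<close>

section \<open>Counter programs\<close>

datatype instr = Skip | Inc nat | Dec nat | IfZero nat | Copy nat nat | Clear nat

fun exec :: "instr \<Rightarrow> (nat \<Rightarrow> nat) \<Rightarrow> (nat \<Rightarrow> nat) \<Rightarrow> bool" where
  "exec Skip m m' \<longleftrightarrow> m' = m"
| "exec (Inc r) m m' \<longleftrightarrow> m' = m(r := Suc (m r))"
| "exec (Dec r) m m' \<longleftrightarrow> m r > 0 \<and> m' = m(r := m r - 1)"
| "exec (IfZero r) m m' \<longleftrightarrow> m r = 0 \<and> m' = m"
| "exec (Copy r s) m m' \<longleftrightarrow> m' = m(r := m s)"
| "exec (Clear r) m m' \<longleftrightarrow> m' = m(r := 0)"

text \<open>\<open>Dec\<close> and \<open>IfZero\<close> block when their tests fail, so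
  \<open>Star\<close> followed by a test expresses a while loop.\<close>

datatype prog = Instr instr | Seq prog prog (infixr \<open>;;\<close> 60) | Star prog

primrec sem :: "prog \<Rightarrow> (nat \<Rightarrow> nat) \<Rightarrow> (nat \<Rightarrow> nat) \<Rightarrow> bool" where
  "sem (Instr i) = exec i"
| "sem (P ;; Q) = sem P OO sem Q"
| "sem (Star P) = (sem P)\<^sup>*\<^sup>*"

section \<open>Compiling partial recursive functions\<close>

definition Fail :: prog where
  "Fail = Instr (Inc 0) ;; Instr (IfZero 0)"

lemma sem_Fail [simp]: "\<not> sem Fail m m'"
  by (auto simp: Fail_def)

text \<open>The arguments are in the registers \<open>as\<close>, all of them below \<open>k\<close>. The result is left
  in register \<open>k\<close>, and the registers from \<open>k\<close> on are free for use.\<close>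

fun compile :: "recf \<Rightarrow> nat list \<Rightarrow> nat \<Rightarrow> prog"
  and compile_list :: "recf list \<Rightarrow> nat list \<Rightarrow> nat \<Rightarrow> prog" where
  "compile Zero as k = Instr (Clear k)"
| "compile Succ as k =
     (case as of [] \<Rightarrow> Fail | a # _ \<Rightarrow> Instr (Copy k a) ;; Instr (Inc k))"
| "compile (Proj i) as k = (if i < length as then Instr (Copy k (as ! i)) else Fail)"
| "compile (Comp f gs) as k =
     compile_list gs as k ;; compile f [k..<k + length gs] (k + length gs) ;;
     Instr (Copy k (k + length gs))"
| "compile (Prim f g) as k =
     (case as of [] \<Rightarrow> Fail
      | a # as \<Rightarrow>
          Instr (Copy k a) ;; Instr (Clear (k + 1)) ;; compile f as (k + 2) ;;
          Star (Instr (Dec k) ;; compile g ((k + 1) # (k + 2) # as) (k + 3) ;;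
                Instr (Copy (k + 2) (k + 3)) ;; Instr (Inc (k + 1))) ;;
          Instr (IfZero k) ;; Instr (Copy k (k + 2)))"
| "compile (Mu f) as k =
     Instr (Clear k) ;;
     Star (compile f (k # as) (k + 1) ;; Instr (Dec (k + 1)) ;; Instr (Inc k)) ;;
     compile f (k # as) (k + 1) ;; Instr (IfZero (k + 1))"
| "compile_list [] as k = Instr Skip"
| "compile_list (g # gs) as k = compile g as k ;; compile_list gs as (Suc k)"

text \<open>Programs are nondeterministic, so correctness has two halves: every outcome is right,
  and some outcome exists whenever the function is defined. The clause on registers below
  \<open>k\<close> lets calls be nested.\<close>

definition computes :: "recf \<Rightarrow> bool" where
  "computes f \<longleftrightarrow> (\<forall>as k m. set as \<subseteq> {..<k} \<longrightarrow>
     (\<forall>m'. sem (compile f as k) m m' \<longrightarrow>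
        eval f (map m as) = Some (m' k) \<and> (\<forall>r<k. m' r = m r)) \<and>
     (\<forall>y. eval f (map m as) = Some y \<longrightarrow> (\<exists>m'. sem (compile f as k) m m')))"

section \<open>Correctness of compiled programs\<close>

lemma computes_sound:
  assumes "computes f" "sem (compile f as k) m m'" "set as \<subseteq> {..<k}"
  shows "eval f (map m as) = Some (m' k)" "r < k \<Longrightarrow> m' r = m r"
  using assms unfolding computes_def by blast+

lemma computes_complete:
  assumes "computes f" "eval f (map m as) = Some y" "set as \<subseteq> {..<k}"
  obtains m' where "sem (compile f as k) m m'" "m' k = y" "\<forall>r<k. m' r = m r"
  using assms unfolding computes_def by (metis option.inject)

text \<open>Each call works from its own \<open>k\<close> upwards and the next one starts at
  \<open>Suc k\<close>, so the arguments and the earlier results stay intact.\<close>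

lemma compile_list_sound:
  assumes "\<forall>g\<in>set gs. computes g" "sem (compile_list gs as k) m m'" "set as \<subseteq> {..<k}"
  shows "map (\<lambda>g. eval g (map m as)) gs = map Some (map m' [k..<k + length gs]) \<and>
    (\<forall>r<k. m' r = m r)"
  using assms
proof (induction gs arbitrary: k m)
  case (Cons g gs)
  then obtain m1 where m1: "sem (compile g as k) m m1" "sem (compile_list gs as (Suc k)) m1 m'"
    by auto
  have g: "eval g (map m as) = Some (m1 k)" "\<And>r. r < k \<Longrightarrow> m1 r = m r"
    using Cons.prems m1 computes_sound[of g as k m m1] by auto
  have args: "map m1 as = map m as" using g(2) Cons.prems(3) by auto
  have "set as \<subseteq> {..<Suc k}" using Cons.prems(3) by auto
  then have "map (\<lambda>g. eval g (map m as)) gs = map Some (map m' [Suc k..<Suc k + length gs]) \<and>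
    (\<forall>r<Suc k. m' r = m1 r)"
    using Cons.IH[OF _ m1(2), unfolded args] Cons.prems(1) by (simp del: upt_Suc)
  then show ?case using g by (simp add: upt_conv_Cons del: upt_Suc)
qed simp

lemma compile_list_complete:
  assumes "\<forall>g\<in>set gs. computes g" "\<forall>g\<in>set gs. eval g (map m as) \<noteq> None" "set as \<subseteq> {..<k}"
  shows "\<exists>m'. sem (compile_list gs as k) m m'"
  using assms
proof (induction gs arbitrary: k m)
  case (Cons g gs)
  then obtain m1 where m1: "sem (compile g as k) m m1" "\<forall>r<k. m1 r = m r"
    by (metis computes_complete list.set_intros(1) not_None_eq)
  have args: "map m1 as = map m as" using m1 Cons.prems(3) by auto
  have "set as \<subseteq> {..<Suc k}" using Cons.prems(3) by auto
  then obtain m' where "sem (compile_list gs as (Suc k)) m1 m'"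
    using Cons.IH[of m1 "Suc k", unfolded args] Cons.prems(1,2) by auto
  then show ?case using m1 by auto
qed (auto intro: exI[of "exec Skip m" m for m])

lemma computes_Comp:
  assumes f: "computes f" and gs: "\<forall>g\<in>set gs. computes g"
  shows "computes (Comp f gs)"
proof -
  have "(\<forall>m'. sem (compile (Comp f gs) as k) m m' \<longrightarrow>
        eval (Comp f gs) (map m as) = Some (m' k) \<and> (\<forall>r<k. m' r = m r)) \<and>
     (\<forall>y. eval (Comp f gs) (map m as) = Some y \<longrightarrow> (\<exists>m'. sem (compile (Comp f gs) as k) m m'))"
    if as: "set as \<subseteq> {..<k}" for as k m
  proof -
    let ?n = "k + length gs"
    have sub: "set [k..<?n] \<subseteq> {..<?n}" by auto
    have vals: "(\<forall>g\<in>set gs. eval g (map m as) \<noteq> None) \<and>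
        map (\<lambda>g. the (eval g (map m as))) gs = map m1 [k..<?n]" "\<forall>r<k. m1 r = m r"
      if "sem (compile_list gs as k) m m1" for m1
    proof -
      have *: "map (\<lambda>g. eval g (map m as)) gs = map Some (map m1 [k..<?n])" "\<forall>r<k. m1 r = m r"
        using compile_list_sound[OF gs that as] by auto
      have "None \<notin> set (map (\<lambda>g. eval g (map m as)) gs)" unfolding *(1) by auto
      then have "\<forall>g\<in>set gs. eval g (map m as) \<noteq> None"
        by (metis (no_types, lifting) image_eqI list.set_map)
      moreover have "map the (map (\<lambda>g. eval g (map m as)) gs) = map m1 [k..<?n]"
        unfolding *(1) by (simp add: o_def)
      ultimately show "(\<forall>g\<in>set gs. eval g (map m as) \<noteq> None) \<and>
        map (\<lambda>g. the (eval g (map m as))) gs = map m1 [k..<?n]" "\<forall>r<k. m1 r = m r"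
        using *(2) by (auto simp: o_def)
    qed
    show ?thesis
    proof (intro conjI allI impI)
      fix m'
      assume "sem (compile (Comp f gs) as k) m m'"
      then obtain m1 m2 where m: "sem (compile_list gs as k) m m1"
        "sem (compile f [k..<?n] ?n) m1 m2" "m' = m2(k := m2 ?n)"
        by auto
      note s = computes_sound[OF f m(2) sub]
      show "eval (Comp f gs) (map m as) = Some (m' k)"
        using vals[OF m(1)] s(1) m(3) by simp
      show "m' r = m r" if "r < k" for r
        using vals[OF m(1)] s(2)[of r] m(3) that by simp
    next
      fix y
      assume y: "eval (Comp f gs) (map m as) = Some y"
      then have "\<forall>g\<in>set gs. eval g (map m as) \<noteq> None" by (auto split: if_splits)
      then obtain m1 where m1: "sem (compile_list gs as k) m m1"
        using compile_list_complete[OF gs _ as] by blast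
      have "eval f (map m1 [k..<?n]) = Some y" using vals(1)[OF m1] y by simp
      then obtain m2 where "sem (compile f [k..<?n] ?n) m1 m2"
        using computes_complete[OF f _ sub] by blast
      with m1 show "\<exists>m'. sem (compile (Comp f gs) as k) m m'" by (auto simp: relcompp_apply)
    qed
  qed
  then show ?thesis unfolding computes_def by blast
qed

lemma computes_Prim:
  assumes f: "computes f" and g: "computes g"
  shows "computes (Prim f g)"
proof -
  have "(\<forall>m'. sem (compile (Prim f g) as k) m m' \<longrightarrow>
        eval (Prim f g) (map m as) = Some (m' k) \<and> (\<forall>r<k. m' r = m r)) \<and>
     (\<forall>y. eval (Prim f g) (map m as) = Some y \<longrightarrow> (\<exists>m'. sem (compile (Prim f g) as k) m m'))"
    if as': "set as \<subseteq> {..<k}" for as k m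
  proof (cases as)
    case (Cons a bs)
    define rest where "rest j =
      rec_nat (eval f (map m bs)) (\<lambda>i v. Option.bind v (\<lambda>y. eval g (i # y # map m bs))) j" for j
    define body where "body = Instr (Dec k) ;; compile g ((k + 1) # (k + 2) # bs) (k + 3) ;;
        Instr (Copy (k + 2) (k + 3)) ;; Instr (Inc (k + 1))"
    have a: "a < k" and bs: "set bs \<subseteq> {..<k}" using as' Cons by auto
    have subf: "set bs \<subseteq> {..<k + 2}" and subg: "set ((k + 1) # (k + 2) # bs) \<subseteq> {..<k + 3}"
      using bs by auto
    have evalp: "eval (Prim f g) (map m as) = rest (m a)" by (simp add: Cons rest_def)
    have comp: "sem (compile (Prim f g) as k) m m' \<longleftrightarrow> (\<exists>m1 m2.
        sem (compile f bs (k + 2)) (m(k := m a, k + 1 := 0)) m1 \<and> (sem body)\<^sup>*\<^sup>* m1 m2 \<and>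
        m2 k = 0 \<and> m' = m2(k := m2 (k + 2)))" for m'
      by (auto simp: Cons body_def relcompp_apply)
    \<comment> \<open>Register \<open>k\<close> holds the number of rounds still to do,
      \<open>k + 1\<close> the rounds done, and \<open>k + 2\<close> the value of the recursion
      after them.\<close>
    define inv where "inv v \<longleftrightarrow> rest (v (k + 1)) = Some (v (k + 2)) \<and>
        v k + v (k + 1) = m a \<and> (\<forall>r<k. v r = m r)" for v
    have eq: "map (m(k := x, k + 1 := y)) bs = map m bs" for x y using bs by auto
    have start: "inv m1" if "sem (compile f bs (k + 2)) (m(k := m a, k + 1 := 0)) m1" for m1
      using computes_sound[OF f that subf, unfolded eq] by (auto simp: inv_def rest_def)
    have stepg: "inv v'" if v: "inv v" "sem body v v'" for v v'
    proof -
      obtain w where w: "v k > 0" "sem (compile g ((k + 1) # (k + 2) # bs) (k + 3)) (v(k := v k - 1)) w"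
        and v': "v' = w(k + 2 := w (k + 3), k + 1 := Suc (w (k + 1)))"
        using v(2) by (auto simp: body_def)
      have "map (v(k := v k - 1)) ((k + 1) # (k + 2) # bs) = v (k + 1) # v (k + 2) # map m bs"
        using v(1) bs by (auto simp: inv_def)
      from computes_sound[OF g w(2) subg, unfolded this] have
        *: "eval g (v (k + 1) # v (k + 2) # map m bs) = Some (w (k + 3))"
          "\<And>r. r < k + 3 \<Longrightarrow> w r = (v(k := v k - 1)) r" by auto
      show ?thesis using v(1) *(1) w(1) *(2)[of k] *(2)[of "k + 1"] *(2) v'
        by (auto simp: inv_def rest_def)
    qed
    show ?thesis
    proof (intro conjI allI impI)
      fix m'
      assume "sem (compile (Prim f g) as k) m m'"
      then obtain m1 m2 where m: "sem (compile f bs (k + 2)) (m(k := m a, k + 1 := 0)) m1"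
        "(sem body)\<^sup>*\<^sup>* m1 m2" "m2 k = 0" "m' = m2(k := m2 (k + 2))"
        unfolding comp by blast
      have "inv m2" using m(2) start[OF m(1)] by (induction) (auto intro: stepg)
      then show "eval (Prim f g) (map m as) = Some (m' k)" "\<And>r. r < k \<Longrightarrow> m' r = m r"
        using m(3,4) unfolding evalp by (auto simp: inv_def)
    next
      fix y
      assume y: "eval (Prim f g) (map m as) = Some y"
      \<comment> \<open>A recursion step yields no value from an undefined one, so definedness at
        \<open>m a\<close> passes down to all smaller arguments.\<close>
      have defd: "rest j \<noteq> None" if "j \<le> m a" for j
        using that
      proof (induction rule: inc_induct)
        case base then show ?case using y unfolding evalp by simp
      next
        case (step n) then show ?case by (cases "rest n") (auto simp: rest_def)
      qed
      \<comment> \<open>Each round decrements register \<open>k\<close>, the induction measure;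
        \<open>defd\<close> supplies the value needed for the call of \<open>g\<close>.\<close>
      have loop: "\<exists>v'. (sem body)\<^sup>*\<^sup>* v v' \<and> v' k = 0" if "inv v" for v
        using that
      proof (induction "v k" arbitrary: v)
        case 0 then show ?case by auto
      next
        case (Suc c)
        have "rest (Suc (v (k + 1))) \<noteq> None" using Suc.prems Suc.hyps(2) by (intro defd) (auto simp: inv_def)
        then obtain y where "eval g (v (k + 1) # v (k + 2) # map m bs) = Some y"
          using Suc.prems by (auto simp: inv_def rest_def)
        moreover have "map (v(k := v k - 1)) ((k + 1) # (k + 2) # bs) = v (k + 1) # v (k + 2) # map m bs"
          using Suc.prems bs by (auto simp: inv_def)
        ultimately obtain w where w: "sem (compile g ((k + 1) # (k + 2) # bs) (k + 3)) (v(k := v k - 1)) w"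
            "\<forall>r<k+3. w r = (v(k := v k - 1)) r"
          using computes_complete[OF g _ subg] by metis
        define v' where "v' = w(k + 2 := w (k + 3), k + 1 := Suc (w (k + 1)))"
        have b: "sem body v v'" using w Suc.hyps(2) by (auto simp: body_def v'_def relcompp_apply)
        have "v' k = c" using w(2)[rule_format, of k] Suc.hyps(2) by (simp add: v'_def)
        with Suc.hyps(1)[of v'] stepg[OF Suc.prems b] obtain u where "(sem body)\<^sup>*\<^sup>* v' u" "u k = 0" by auto
        with b show ?case by (meson converse_rtranclp_into_rtranclp)
      qed
      have "eval f (map (m(k := m a, k + 1 := 0)) bs) \<noteq> None" using defd[of 0] unfolding eq by (simp add: rest_def)
      then obtain m1 where "sem (compile f bs (k + 2)) (m(k := m a, k + 1 := 0)) m1"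
        using computes_complete[OF f _ subf] by blast
      with loop[OF start[OF this]] show "\<exists>m'. sem (compile (Prim f g) as k) m m'"
        unfolding comp by blast
    qed
  qed simp
  then show ?thesis unfolding computes_def by blast
qed

lemma computes_Mu:
  assumes f: "computes f"
  shows "computes (Mu f)"
proof -
  have "(\<forall>m'. sem (compile (Mu f) as k) m m' \<longrightarrow>
        eval (Mu f) (map m as) = Some (m' k) \<and> (\<forall>r<k. m' r = m r)) \<and>
     (\<forall>y. eval (Mu f) (map m as) = Some y \<longrightarrow> (\<exists>m'. sem (compile (Mu f) as k) m m'))"
    if as: "set as \<subseteq> {..<k}" for as k m
  proof -
    define body where "body = compile f (k # as) (k + 1) ;; Instr (Dec (k + 1)) ;; Instr (Inc k)"
    define val where "val n = eval f (n # map m as)" for n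
    have sub: "set (k # as) \<subseteq> {..<k + 1}" using as by auto
    have comp: "sem (compile (Mu f) as k) m m' \<longleftrightarrow> (\<exists>m1. (sem body)\<^sup>*\<^sup>* (m(k := 0)) m1 \<and>
        sem (compile f (k # as) (k + 1)) m1 m' \<and> m' (k + 1) = 0)" for m'
      by (auto simp: body_def relcompp_apply)
    \<comment> \<open>The candidate in register \<open>k\<close> has passed only arguments with
      defined, nonzero values, because \<open>Dec (k + 1)\<close> in the body blocks on 0.\<close>
    define inv where "inv v \<longleftrightarrow> (\<forall>i<v k. val i \<noteq> None \<and> val i \<noteq> Some 0) \<and> (\<forall>r<k. v r = m r)" for v
    have start: "inv (m(k := 0))" by (simp add: inv_def)
    have args: "map v (k # as) = v k # map m as" if "inv v" for v
      using that as by (auto simp: inv_def)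
    have call: "val (v k) = Some (w (k + 1))" "w k = v k" "\<forall>r<k. w r = m r"
      if "inv v" "sem (compile f (k # as) (k + 1)) v w" for v w
      using computes_sound[OF f that(2) sub, unfolded args[OF that(1)]] that(1)
      by (auto simp: val_def inv_def)
    have step: "inv v'" if v: "inv v" "sem body v v'" for v v'
    proof -
      obtain w where "sem (compile f (k # as) (k + 1)) v w" "w (k + 1) > 0"
        "v' = w(k + 1 := w (k + 1) - 1, k := Suc (w k))"
        using v(2) by (auto simp: body_def)
      with call[OF v(1) this(1)] v(1) show ?thesis by (auto simp: inv_def less_Suc_eq)
    qed
    show ?thesis
    proof (intro conjI allI impI)
      fix m'
      assume "sem (compile (Mu f) as k) m m'"
      then obtain m1 where m: "(sem body)\<^sup>*\<^sup>* (m(k := 0)) m1"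
        "sem (compile f (k # as) (k + 1)) m1 m'" "m' (k + 1) = 0"
        unfolding comp by blast
      have i: "inv m1" using m(1) start by (induction) (auto intro: step)
      note c = call[OF i m(2)]
      have v: "val (m' k) = Some 0" "\<forall>i<m' k. val i \<noteq> None \<and> val i \<noteq> Some 0"
        using c i m(3) by (auto simp: inv_def)
      then have "(LEAST n. val n = Some 0) = m' k"
        by (intro Least_equality) (auto simp: not_le[symmetric])
      with v show "eval (Mu f) (map m as) = Some (m' k)" by (auto simp: val_def)
      show "\<And>r. r < k \<Longrightarrow> m' r = m r" using c by auto
    next
      fix y
      assume y: "eval (Mu f) (map m as) = Some y"
      then obtain n where n: "val n = Some 0" "\<forall>i<n. val i \<noteq> None" and "y = (LEAST n. val n = Some 0)"
        by (auto simp: val_def split: if_splits)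
      \<comment> \<open>Minimality alone does not make the values below \<open>y\<close> defined;
        this comes from \<open>y \<le> n\<close>, as all values below \<open>n\<close> are
        defined.\<close>
      then have y0: "val y = Some 0" and "y \<le> n" by (auto intro: LeastI Least_le)
      then have yd: "val i \<noteq> None \<and> val i \<noteq> Some 0" if "i < y" for i
        using that n(2) not_less_Least[of i "\<lambda>n. val n = Some 0"] \<open>y = _\<close> by auto
      have callc: "\<exists>w. sem (compile f (k # as) (k + 1)) v w" if "inv v" "val (v k) \<noteq> None" for v
        using computes_complete[OF f _ sub, of v] args[OF that(1)] that(2) unfolding val_def
        by (metis not_Some_eq)
      \<comment> \<open>Before \<open>y\<close> the values are nonzero, so the decrement in the body
        succeeds and the search moves up to \<open>y\<close>.\<close>
      have loop: "\<exists>v'. (sem body)\<^sup>*\<^sup>* v v' \<and> v' k = y \<and> inv v'" if "inv v" "v k \<le> y" for v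
        using that
      proof (induction "y - v k" arbitrary: v)
        case 0 then show ?case by auto
      next
        case (Suc c)
        then have "val (v k) \<noteq> None \<and> val (v k) \<noteq> Some 0" by (intro yd) auto
        moreover from this obtain w where w: "sem (compile f (k # as) (k + 1)) v w"
          using callc[OF Suc.prems(1)] by blast
        ultimately have pos: "w (k + 1) > 0" using call[OF Suc.prems(1) w] by auto
        define v' where "v' = w(k + 1 := w (k + 1) - 1, k := Suc (w k))"
        have b: "sem body v v'" using w pos by (auto simp: body_def v'_def relcompp_apply)
        have "v' k = Suc (v k)" using call[OF Suc.prems(1) w] by (simp add: v'_def)
        moreover have "c = y - Suc (v k)" "Suc (v k) \<le> y" using Suc.hyps(2) by auto
        ultimately obtain u where "(sem body)\<^sup>*\<^sup>* v' u" "u k = y" "inv u"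
          using Suc.hyps(1)[of v'] step[OF Suc.prems(1) b] by auto
        with b show ?case by (intro exI[of _ u]) (auto intro: converse_rtranclp_into_rtranclp)
      qed
      then obtain m1 where m1: "(sem body)\<^sup>*\<^sup>* (m(k := 0)) m1" "m1 k = y" "inv m1"
        using start by (metis fun_upd_same le0)
      obtain m' where m': "sem (compile f (k # as) (k + 1)) m1 m'"
        using callc[OF m1(3)] m1(2) y0 by auto
      have "m' (k + 1) = 0" using call[OF m1(3) m'] m1(2) y0 by simp
      with m1 m' show "\<exists>m'. sem (compile (Mu f) as k) m m'" unfolding comp by blast
    qed
  qed
  then show ?thesis unfolding computes_def by blast
qed

lemma compile_computes: "computes f"
proof (induction f)
  case Zero show ?case by (auto simp: computes_def)
next
  case Succ show ?case by (auto simp: computes_def relcompp_apply split: list.splits)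
next
  case (Proj i) show ?case by (auto simp: computes_def)
qed (auto intro: computes_Comp computes_Prim computes_Mu)

section \<open>Programs as graphs\<close>

type_synonym edge = "nat \<times> instr \<times> nat"

primrec width :: "prog \<Rightarrow> nat" where
  "width (Instr i) = 0"
| "width (P ;; Q) = Suc (width P + width Q)"
| "width (Star P) = Suc (width P)"

text \<open>The graph of a program leads from node \<open>a\<close> to node \<open>b\<close>; its inner nodes are
  \<open>n, \<dots>, n + width P - 1\<close>.\<close>

primrec graph :: "prog \<Rightarrow> nat \<Rightarrow> nat \<Rightarrow> nat \<Rightarrow> edge set" where
  "graph (Instr i) a b n = {(a, i, b)}"
| "graph (P ;; Q) a b n = graph P a n (Suc n) \<union> graph Q n b (Suc n + width P)"
| "graph (Star P) a b n = {(a, Skip, b), (a, Skip, n)} \<union> graph P n a (Suc n)"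

definition move :: "edge set \<Rightarrow> nat \<times> (nat \<Rightarrow> nat) \<Rightarrow> nat \<times> (nat \<Rightarrow> nat) \<Rightarrow> bool" where
  "move E c c' \<longleftrightarrow> (\<exists>i. (fst c, i, fst c') \<in> E \<and> exec i (snd c) (snd c'))"

lemma graph_complete:
  "sem P m m' \<Longrightarrow> graph P a b n \<subseteq> E \<Longrightarrow> (move E)\<^sup>*\<^sup>* (a, m) (b, m')"
proof (induction P arbitrary: a b n m m')
  case (Instr i)
  then show ?case by (auto simp: move_def intro!: r_into_rtranclp)
next
  case (Seq P Q)
  then obtain m1 where "sem P m m1" "sem Q m1 m'" by auto
  then have "(move E)\<^sup>*\<^sup>* (a, m) (n, m1)" "(move E)\<^sup>*\<^sup>* (n, m1) (b, m')"
    using Seq.IH Seq.prems(2) by auto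
  then show ?case by simp
next
  case (Star P)
  have "(sem P)\<^sup>*\<^sup>* m m'" using Star.prems by simp
  then have "(move E)\<^sup>*\<^sup>* (a, m) (a, m')"
  proof (induction)
    case (step m1 m2)
    have "move E (a, m1) (n, m1)" using Star.prems(2) by (auto simp: move_def)
    moreover have "(move E)\<^sup>*\<^sup>* (n, m1) (a, m2)" using Star.IH[OF step(2), of n a "Suc n"] Star.prems(2) by simp
    ultimately show ?case using step by (meson converse_rtranclp_into_rtranclp rtranclp_trans)
  qed simp
  moreover have "move E (a, m') (b, m')" using Star.prems(2) by (auto simp: move_def)
  ultimately show ?case by simp
qed

text \<open>This decides which part of a composed graph can own an edge leaving a given
  node.\<close>

lemma graph_sources: "(q, i, q') \<in> graph P a b n \<Longrightarrow> q = a \<or> n \<le> q \<and> q < n + width P"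
  by (induction P arbitrary: a b n) fastforce+

lemma graph_targets: "(q, i, q') \<in> graph P a b n \<Longrightarrow> q' = b \<or> q' = a \<or> n \<le> q' \<and> q' < n + width P"
  by (induction P arbitrary: a b n) fastforce+

lemma finite_graph: "finite (graph P a b n)"
  by (induction P arbitrary: a b n) auto

text \<open>The walk takes place in a larger graph and goes on beyond the exit \<open>b\<close>, so that the
  statement can be chained along the parts of a program. The bound \<open>l' < l\<close> serves the
  induction for loops.\<close>

lemma graph_sound:
  assumes "(move E ^^ l) (a, m) (z, m'')"
    and "\<forall>q i q'. q = a \<or> n \<le> q \<and> q < n + width P \<longrightarrow> (q, i, q') \<in> E \<longleftrightarrow> (q, i, q') \<in> graph P a b n"
    and "z \<noteq> a" "\<not> (n \<le> z \<and> z < n + width P)" "\<not> (n \<le> a \<and> a < n + width P)"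
  shows "\<exists>m' l'. l' < l \<and> sem P m m' \<and> (move E ^^ l') (b, m') (z, m'')"
  using assms
proof (induction P arbitrary: a b n m l)
  case (Instr i)
  then obtain l' where l: "l = Suc l'" by (cases l) auto
  then obtain q1 m1 where "move E (a, m) (q1, m1)" "(move E ^^ l') (q1, m1) (z, m'')"
    using Instr.prems(1) by (metis old.prod.exhaust relpowp_Suc_D2)
  moreover from this have "q1 = b" "exec i m m1" using Instr.prems(2) by (auto simp: move_def)
  ultimately show ?case using l by auto
next
  case (Seq P Q)
  have E: "(q, i, q') \<in> E \<longleftrightarrow> (q, i, q') \<in> graph P a n (Suc n) \<or> (q, i, q') \<in> graph Q n b (Suc n + width P)"
    if "q = a \<or> n \<le> q \<and> q < n + Suc (width P + width Q)" for q i q'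
    using Seq.prems(2) that by auto
  \<comment> \<open>No node is a source in both halves, so at the entry and inner nodes of either
    half \<open>E\<close> agrees with the graph of that half, as the induction hypotheses
    require.\<close>
  have P: "(q, i, q') \<notin> graph P a n (Suc n)" if "q \<noteq> a" "q \<le> n \<or> q > n + width P" for q i q'
    using graph_sources[of q i q' P a n "Suc n"] that by auto
  have Q: "(q, i, q') \<notin> graph Q n b (Suc n + width P)"
    if "q \<noteq> n" "q < Suc n + width P \<or> q > n + width P + width Q" for q i q'
    using graph_sources[of q i q' Q n b "Suc n + width P"] that by auto
  have a: "a < n \<or> a > n + width P + width Q" using Seq.prems(5) by auto
  have "\<exists>m' l'. l' < l \<and> sem P m m' \<and> (move E ^^ l') (n, m') (z, m'')"
  proof (rule Seq.IH(1)[OF Seq.prems(1)])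
    show "\<forall>q i q'. q = a \<or> Suc n \<le> q \<and> q < Suc n + width P \<longrightarrow>
        (q, i, q') \<in> E \<longleftrightarrow> (q, i, q') \<in> graph P a n (Suc n)"
      using E Q a by (intro allI impI) auto
  qed (use Seq.prems in auto)
  then obtain m1 l1 where 1: "l1 < l" "sem P m m1" "(move E ^^ l1) (n, m1) (z, m'')" by blast
  have "\<exists>m' l'. l' < l1 \<and> sem Q m1 m' \<and> (move E ^^ l') (b, m') (z, m'')"
  proof (rule Seq.IH(2)[OF 1(3)])
    show "\<forall>q i q'. q = n \<or> Suc n + width P \<le> q \<and> q < Suc n + width P + width Q \<longrightarrow>
        (q, i, q') \<in> E \<longleftrightarrow> (q, i, q') \<in> graph Q n b (Suc n + width P)"
      using E P a by (intro allI impI) auto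
  qed (use Seq.prems in auto)
  with 1 show ?case by (auto intro: less_trans)
next
  case (Star P)
  have E: "(q, i, q') \<in> E \<longleftrightarrow> (q, i, q') \<in> graph (Star P) a b n"
    if "q = a \<or> n \<le> q \<and> q < n + Suc (width P)" for q i q'
    using Star.prems(2) that by auto
  have P: "(q, i, q') \<notin> graph P n a (Suc n)" if "q < n \<or> q > n + width P" for q i q'
    using graph_sources[of q i q' P n a "Suc n"] that by auto
  have a: "a < n \<or> a > n + width P" using Star.prems(5) by auto
  \<comment> \<open>The walk may return to \<open>a\<close> arbitrarily often, so a second induction
    runs over the length of the remaining walk.\<close>
  from Star.prems(1) show ?case
  proof (induction l arbitrary: m rule: less_induct)
    case (less l)
    then obtain l1 where l: "l = Suc l1" using Star.prems(3) by (cases l) auto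
    then obtain q1 m1 where 1: "move E (a, m) (q1, m1)" "(move E ^^ l1) (q1, m1) (z, m'')"
      using less.prems by (metis old.prod.exhaust relpowp_Suc_D2)
    then obtain i where "(a, i, q1) \<in> graph (Star P) a b n" "exec i m m1"
      using E by (auto simp: move_def)
    \<comment> \<open>\<open>a\<close> is no source inside the body, so only the two
      \<open>Skip\<close> edges leave it.\<close>
    then have m1: "m1 = m" "q1 = b \<or> q1 = n" using P[of a] a by auto
    show ?case
    proof (cases "q1 = b")
      case True
      then show ?thesis using 1(2) m1 l by auto
    next
      case False
      then have "(move E ^^ l1) (n, m) (z, m'')" using m1 1(2) by simp
      then have "\<exists>m' l'. l' < l1 \<and> sem P m m' \<and> (move E ^^ l') (a, m') (z, m'')"
      proof (rule Star.IH)
        show "\<forall>q i q'. q = n \<or> Suc n \<le> q \<and> q < Suc n + width P \<longrightarrow>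
            (q, i, q') \<in> E \<longleftrightarrow> (q, i, q') \<in> graph P n a (Suc n)"
          using E a by (intro allI impI) auto
      qed (use Star.prems in auto)
      then obtain m2 l2 where 2: "l2 < l1" "sem P m m2" "(move E ^^ l2) (a, m2) (z, m'')" by blast
      then obtain m3 l3 where "l3 < l2" "sem (Star P) m2 m3" "(move E ^^ l3) (b, m3) (z, m'')"
        using less.IH[of l2 m2] l by auto
      then show ?thesis using 2 l
        by (intro exI[of _ m3] exI[of _ l3]) (auto intro: converse_rtranclp_into_rtranclp)
    qed
  qed
qed

section \<open>Graphs as register set automata\<close>

fun instr_regs :: "instr \<Rightarrow> nat set" where
  "instr_regs Skip = {}"
| "instr_regs (Inc r) = {r}"
| "instr_regs (Dec r) = {r}"
| "instr_regs (IfZero r) = {r}"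
| "instr_regs (Copy r s) = {r, s}"
| "instr_regs (Clear r) = {r}"

fun instr_update :: "instr \<Rightarrow> nat \<Rightarrow> nat source set" where
  "instr_update (Inc r) = (\<lambda>s. {Reg s})(r := {Reg r, In})"
| "instr_update (Copy r r') = (\<lambda>s. {Reg s})(r := {Reg r'})"
| "instr_update (Clear r) = (\<lambda>s. {Reg s})(r := {})"
| "instr_update _ = (\<lambda>s. {Reg s})"

text \<open>A single letter suffices, as only the data drive the counters. The cutoff at
  \<open>K\<close> is what \<open>transition_wf\<close> demands outside the registers.\<close>

definition edge_transition :: "'a \<Rightarrow> nat \<Rightarrow> edge \<Rightarrow> (nat, nat, 'a) transition" where
  "edge_transition a K e = (case e of (q, i, q') \<Rightarrow>
     \<lparr>src = q, letter = a,
      guard_in = (case i of Dec r \<Rightarrow> {r} | _ \<Rightarrow> {}),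
      guard_notin = (case i of Inc r \<Rightarrow> {r} | _ \<Rightarrow> {}),
      guard_empty = (case i of IfZero r \<Rightarrow> {r} | _ \<Rightarrow> {}),
      removal = (case i of Dec r \<Rightarrow> {r} | _ \<Rightarrow> {}),
      update = (\<lambda>s. if s < K then instr_update i s else {}),
      tgt = q'\<rparr>)"

abbreviation counts :: "(nat \<Rightarrow> 'd set) \<Rightarrow> nat \<Rightarrow> nat" where
  "counts f \<equiv> \<lambda>r. card (f r)"

text \<open>Finiteness makes \<open>card\<close> detect emptiness, as \<open>card\<close> of an
  infinite set is 0; emptiness from \<open>K\<close> on makes the cutoff in the updates
  harmless.\<close>

definition bounded :: "nat \<Rightarrow> (nat \<Rightarrow> 'd set) \<Rightarrow> bool" where
  "bounded K f \<longleftrightarrow> (\<forall>r. finite (f r)) \<and> (\<forall>r\<ge>K. f r = {})"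

fun apply_instr :: "instr \<Rightarrow> 'd \<Rightarrow> (nat \<Rightarrow> 'd set) \<Rightarrow> nat \<Rightarrow> 'd set" where
  "apply_instr Skip d f = f"
| "apply_instr (Inc r) d f = f(r := insert d (f r))"
| "apply_instr (Dec r) d f = f(r := f r - {d})"
| "apply_instr (IfZero r) d f = f"
| "apply_instr (Copy r s) d f = f(r := f s)"
| "apply_instr (Clear r) d f = f(r := {})"

lemma next_regs_edge_transition:
  assumes "bounded K f" "instr_regs i \<subseteq> {..<K}"
  shows "next_regs (edge_transition a K (q, i, q')) f d = apply_instr i d f"
proof
  fix s
  have "s \<ge> K \<Longrightarrow> f s = {}" using assms by (simp add: bounded_def)
  then show "next_regs (edge_transition a K (q, i, q')) f d s = apply_instr i d f s"
    using assms(2) by (cases i) (auto simp: next_regs_def edge_transition_def remove_datum_def)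
qed

lemma bounded_apply_instr:
  "bounded K f \<Longrightarrow> instr_regs i \<subseteq> {..<K} \<Longrightarrow> bounded K (apply_instr i d f)"
  by (cases i) (auto simp: bounded_def)

lemma enabled_edge_transition:
  "enabled (edge_transition a K (q, i, q')) f d \<longleftrightarrow>
     (case i of Inc r \<Rightarrow> d \<notin> f r | Dec r \<Rightarrow> d \<in> f r | IfZero r \<Rightarrow> f r = {} | _ \<Rightarrow> True)"
  by (cases i) (auto simp: enabled_def edge_transition_def)

lemma exec_apply_instr:
  assumes "bounded K f" "enabled (edge_transition a K (q, i, q')) f d"
  shows "exec i (counts f) (counts (apply_instr i d f))"
  using assms unfolding enabled_edge_transition
  by (cases i) (auto simp: bounded_def fun_eq_iff card_gt_0_iff)

lemma exec_enabled:
  fixes f :: "nat \<Rightarrow> 'd set"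
  assumes "infinite (UNIV :: 'd set)" "bounded K f" "exec i (counts f) m"
  obtains d where "enabled (edge_transition a K (q, i, q')) f d" "counts (apply_instr i d f) = m"
proof -
  have "\<exists>d. enabled (edge_transition a K (q, i, q')) f d"
    unfolding enabled_edge_transition
  proof (cases i)
    \<comment> \<open>Here the infinite domain enters: a finite register omits some datum.\<close>
    case (Inc r)
    then show "\<exists>d. case i of Inc r \<Rightarrow> d \<notin> f r | Dec r \<Rightarrow> d \<in> f r | IfZero r \<Rightarrow> f r = {} | _ \<Rightarrow> True"
      using assms(1,2) by (simp add: bounded_def ex_new_if_finite)
  qed (use assms(2,3) in \<open>auto simp: bounded_def card_gt_0_iff\<close>)
  then obtain d where d: "enabled (edge_transition a K (q, i, q')) f d" ..
  \<comment> \<open>\<open>exec\<close> is functional in its result, so the step with the datum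
    found reaches exactly \<open>m\<close>.\<close>
  moreover have "exec i (counts f) m' \<Longrightarrow> m' = m" for m'
    using assms(3) by (cases i) auto
  ultimately show ?thesis using exec_apply_instr[OF assms(2) d] that by blast
qed

section \<open>The automaton of a graph and its language\<close>

definition graph_automaton :: "'a \<Rightarrow> nat \<Rightarrow> nat \<Rightarrow> edge set \<Rightarrow> nat \<Rightarrow> (nat, nat, 'a) rsa" where
  "graph_automaton a N K E q0 =
     \<lparr>states = {..<N}, regs = {..<K}, transitions = edge_transition a K ` E,
      initial = {q0}, final = {0}\<rparr>"

lemma rsa_wf_graph_automaton:
  assumes "finite E" "\<And>q i q'. (q, i, q') \<in> E \<Longrightarrow> q < N \<and> q' < N \<and> instr_regs i \<subseteq> {..<K}"
    and "q0 < N"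
  shows "rsa_wf (graph_automaton a N K E q0)"
proof -
  have "transition_wf {..<N} {..<K} (edge_transition a K (q, i, q'))" if "(q, i, q') \<in> E" for q i q'
    using assms(2)[OF that] by (cases i) (auto simp: transition_wf_def edge_transition_def)
  then show ?thesis using assms(1,3) by (auto simp: rsa_wf_def graph_automaton_def)
qed

text \<open>Whatever datum is read, an enabled transition acts on the cardinalities as its
  instruction does on counters.\<close>

lemma run_graph_sound:
  assumes "run (graph_automaton a N K E q0) c w c'" "bounded K (snd c)"
    and "\<And>q i q'. (q, i, q') \<in> E \<Longrightarrow> instr_regs i \<subseteq> {..<K}"
  shows "(move E)\<^sup>*\<^sup>* (fst c, counts (snd c)) (fst c', counts (snd c'))"
  using assms
proof (induction rule: run.induct)
  case (run_Cons c x c' w c'')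
  from run_Cons.hyps(1) obtain q i q' f d where e: "(q, i, q') \<in> E" and c: "c = (q, f)"
    and en: "enabled (edge_transition a K (q, i, q')) f d"
    and c': "c' = (q', next_regs (edge_transition a K (q, i, q')) f d)"
    by (cases rule: step.cases) (auto simp: graph_automaton_def edge_transition_def)
  have r: "instr_regs i \<subseteq> {..<K}" using run_Cons.prems(2) e .
  have b: "bounded K f" using run_Cons.prems(1) c by simp
  have c': "c' = (q', apply_instr i d f)" using c' next_regs_edge_transition[OF b r] by simp
  have "move E (q, counts f) (q', counts (apply_instr i d f))"
    using e exec_apply_instr[OF b en] by (auto simp: move_def)
  moreover have "(move E)\<^sup>*\<^sup>* (fst c', counts (snd c')) (fst c'', counts (snd c''))"
    using run_Cons.IH run_Cons.prems(2) bounded_apply_instr[OF b r] c' by simp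
  ultimately show ?case using c c' by (simp add: converse_rtranclp_into_rtranclp)
qed simp

lemma run_graph_complete:
  fixes f :: "nat \<Rightarrow> 'd set"
  assumes "(move E)\<^sup>*\<^sup>* c (s, m)" "c = (q, counts f)" "bounded K f" "infinite (UNIV :: 'd set)"
    and "\<And>q i q'. (q, i, q') \<in> E \<Longrightarrow> instr_regs i \<subseteq> {..<K}"
  shows "\<exists>w f'. run (graph_automaton a N K E q0) (q, f) w (s, f')"
  using assms(1-3)
proof (induction arbitrary: q f rule: converse_rtranclp_induct)
  case base
  then show ?case using run_Nil by blast
next
  case (step c c')
  then obtain i q' m' where e: "(q, i, q') \<in> E" "exec i (counts f) m'" and c': "c' = (q', m')"
    by (cases c') (auto simp: move_def)
  have r: "instr_regs i \<subseteq> {..<K}" using assms(5) e(1) .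
  obtain d where d: "enabled (edge_transition a K (q, i, q')) f d" "counts (apply_instr i d f) = m'"
    using exec_enabled[OF assms(4) step.prems(2) e(2)] .
  obtain w f' where "run (graph_automaton a N K E q0) (q', apply_instr i d f) w (s, f')"
    using step.IH[of q' "apply_instr i d f"] d(2) c' bounded_apply_instr[OF step.prems(2) r] by auto
  moreover have "step (graph_automaton a N K E q0) (q, f) (a, d) (q', apply_instr i d f)"
  proof -
    have t: "edge_transition a K (q, i, q') \<in> transitions (graph_automaton a N K E q0)"
      using e(1) by (auto simp: graph_automaton_def)
    have "src (edge_transition a K (q, i, q')) = q" "letter (edge_transition a K (q, i, q')) = a"
      "tgt (edge_transition a K (q, i, q')) = q'"
      by (simp_all add: edge_transition_def)
    then show ?thesis
      using step.intros[OF t d(1)] next_regs_edge_transition[OF step.prems(2) r, of a q q' d] by simp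
  qed
  ultimately show ?case by (meson run_Cons)
qed

lemma language_graph_automaton:
  assumes "infinite (UNIV :: 'd set)"
    and "\<And>q i q'. (q, i, q') \<in> E \<Longrightarrow> instr_regs i \<subseteq> {..<K}"
  shows "(language (graph_automaton a N K E q0) :: ('a \<times> 'd) list set) \<noteq> {} \<longleftrightarrow>
    (\<exists>m. (move E)\<^sup>*\<^sup>* (q0, \<lambda>_. 0) (0, m))"
proof -
  have b: "bounded K (\<lambda>_. {} :: 'd set)" by (simp add: bounded_def)
  have "(\<exists>w f'. run (graph_automaton a N K E q0) (q0, \<lambda>_. {} :: 'd set) w (0, f')) \<longleftrightarrow>
      (\<exists>m. (move E)\<^sup>*\<^sup>* (q0, \<lambda>_. 0) (0, m))"
    using run_graph_sound[where K = K and E = E and c = "(q0, \<lambda>_. {} :: 'd set)"] b assms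
      run_graph_complete[where K = K and E = E and f = "\<lambda>_. {} :: 'd set"]
    by (fastforce simp del: split_paired_Ex)
  then show ?thesis by (auto simp: language_def graph_automaton_def)
qed

section \<open>Total recursive functions\<close>

text \<open>Only the values on lists of length \<open>k\<close> matter, so \<open>h\<close> may be
  any expression in \<open>xs\<close>, and composite functions are handled by introduction
  rules.\<close>

definition recursive :: "nat \<Rightarrow> (nat list \<Rightarrow> nat) \<Rightarrow> bool" where
  "recursive k h \<longleftrightarrow> (\<exists>f. \<forall>xs. length xs = k \<longrightarrow> eval f xs = Some (h xs))"

lemma recursive_cong:
  "recursive k h \<Longrightarrow> (\<And>xs. length xs = k \<Longrightarrow> h xs = h' xs) \<Longrightarrow> recursive k h'"
  by (auto simp: recursive_def)

lemma recursive_nth: "i < k \<Longrightarrow> recursive k (\<lambda>xs. xs ! i)"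
  unfolding recursive_def by (rule exI[of _ "Proj i"]) simp

lemma recursive_hd: "0 < k \<Longrightarrow> recursive k hd"
  by (rule recursive_cong[OF recursive_nth[of 0]]) (auto simp: hd_conv_nth)

lemma recursive_tl_nth: "Suc i < k \<Longrightarrow> recursive k (\<lambda>xs. tl xs ! i)"
  by (rule recursive_cong[OF recursive_nth[of "Suc i"]]) (auto simp: nth_tl)

lemma recursive_Suc:
  assumes "recursive k h"
  shows "recursive k (\<lambda>xs. Suc (h xs))"
proof -
  obtain f where "\<forall>xs. length xs = k \<longrightarrow> eval f xs = Some (h xs)"
    using assms by (auto simp: recursive_def)
  then show ?thesis unfolding recursive_def by (intro exI[of _ "Comp Succ [f]"]) simp
qed

lemma recursive_const: "recursive k (\<lambda>_. c)"
proof (induction c)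
  case 0
  show ?case unfolding recursive_def by (rule exI[of _ Zero]) simp
qed (rule recursive_Suc)

text \<open>Addition, bounded sums and powers of two below are instances. Projections pass the
  parameters on to the recursion.\<close>

lemma recursive_rec_nat:
  assumes "recursive k b" "recursive (Suc (Suc k)) s" "recursive k n"
  shows "recursive k (\<lambda>xs. rec_nat (b xs) (\<lambda>i y. s (i # y # xs)) (n xs))"
proof -
  obtain fb fs fn where fb: "\<And>xs. length xs = k \<Longrightarrow> eval fb xs = Some (b xs)"
    and fs: "\<And>xs. length xs = Suc (Suc k) \<Longrightarrow> eval fs xs = Some (s xs)"
    and fn: "\<And>xs. length xs = k \<Longrightarrow> eval fn xs = Some (n xs)"
    using assms unfolding recursive_def by blast
  have "eval (Comp (Prim fb fs) (fn # map Proj [0..<k])) xs =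
      Some (rec_nat (b xs) (\<lambda>i y. s (i # y # xs)) (n xs))" if len: "length xs = k" for xs
  proof -
    have "map (\<lambda>g. the (eval g xs)) (map Proj [0..<k]) = xs"
      using len by (intro nth_equalityI) auto
    moreover have "rec_nat (eval fb xs) (\<lambda>i v. Option.bind v (\<lambda>y. eval fs (i # y # xs))) j =
        Some (rec_nat (b xs) (\<lambda>i y. s (i # y # xs)) j)" for j
      by (induction j) (auto simp: fb fs len)
    ultimately show ?thesis using len by (auto simp: fn o_def)
  qed
  then show ?thesis unfolding recursive_def by blast
qed

lemma recursive_reindex:
  assumes "recursive (length is) h" "\<forall>i\<in>set is. i < k"
  shows "recursive k (\<lambda>xs. h (map ((!) xs) is))"
proof -
  obtain f where f: "\<And>xs. length xs = length is \<Longrightarrow> eval f xs = Some (h xs)"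
    using assms(1) unfolding recursive_def by blast
  have "eval (Comp f (map Proj is)) xs = Some (h (map ((!) xs) is))" if "length xs = k" for xs
  proof -
    have "map (\<lambda>g. the (eval g xs)) (map Proj is) = map ((!) xs) is"
      using that assms(2) by auto
    then show ?thesis using that assms(2) f by (auto simp del: map_map)
  qed
  then show ?thesis unfolding recursive_def by blast
qed

section \<open>Arithmetic and encodings\<close>

lemma recursive_add:
  assumes "recursive k g" "recursive k h"
  shows "recursive k (\<lambda>xs. g xs + h xs)"
proof -
  have "rec_nat a (\<lambda>i y. Suc y) n = a + n" for a n :: nat by (induction n) auto
  then show ?thesis
    using recursive_rec_nat[OF assms(1) recursive_Suc[OF recursive_nth[of 1]] assms(2)] by simp
qed

lemma recursive_sum:
  assumes "recursive (Suc k) (\<lambda>ys. h (hd ys) (tl ys))" "recursive k n"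
  shows "recursive k (\<lambda>xs. \<Sum>i<n xs. h i xs)"
proof -
  \<comment> \<open>The step function of the recursion receives index, accumulator and parameters;
    \<open>ids\<close> skips position 1, the accumulator, which \<open>h\<close> does not
    take.\<close>
  define ids where "ids = 0 # map (\<lambda>i. i + 2) [0..<k]"
  have "recursive (length ids) (\<lambda>ys. h (hd ys) (tl ys))" using assms(1) by (simp add: ids_def)
  then have "recursive (Suc (Suc k)) (\<lambda>zs. h (hd (map ((!) zs) ids)) (tl (map ((!) zs) ids)))"
    by (rule recursive_reindex) (auto simp: ids_def)
  then have "recursive (Suc (Suc k)) (\<lambda>zs. zs ! 1 + h (hd (map ((!) zs) ids)) (tl (map ((!) zs) ids)))"
    by (intro recursive_add recursive_nth) simp
  note rec = recursive_rec_nat[OF recursive_const[of k 0] this assms(2)]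
  show ?thesis
  proof (rule recursive_cong[OF rec])
    fix xs :: "nat list"
    assume len: "length xs = k"
    have "map ((!) (i # y # xs)) ids = i # xs" for i y
      using len by (intro nth_equalityI) (auto simp: ids_def nth_Cons split: nat.splits)
    then have "rec_nat 0 (\<lambda>i y. (i # y # xs) ! 1 + h (hd (map ((!) (i # y # xs)) ids))
        (tl (map ((!) (i # y # xs)) ids))) j = (\<Sum>i<j. h i xs)" for j
      by (induction j) (simp_all del: list.map)
    then show "rec_nat 0 (\<lambda>i y. (i # y # xs) ! 1 + h (hd (map ((!) (i # y # xs)) ids))
        (tl (map ((!) (i # y # xs)) ids))) (n xs) = (\<Sum>i<n xs. h i xs)" .
  qed
qed

text \<open>Each power arises by doubling, that is by addition, so multiplication is
  avoided.\<close>

lemma recursive_power2: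
  assumes "recursive k h"
  shows "recursive k (\<lambda>xs. 2 ^ h xs)"
proof -
  have "rec_nat (Suc 0) (\<lambda>i y. y + y) n = 2 ^ n" for n :: nat by (induction n) auto
  then show ?thesis
    using recursive_rec_nat[OF recursive_const
        recursive_add[OF recursive_nth[of 1] recursive_nth[of 1]] assms, of "Suc 0"] by simp
qed

text \<open>Writing triangular numbers as sums avoids the division in their closed form.\<close>

lemma recursive_prod_encode:
  assumes "recursive k g" "recursive k h"
  shows "recursive k (\<lambda>xs. prod_encode (g xs, h xs))"
proof -
  have "triangle n = (\<Sum>i<n. Suc i)" for n by (induction n) auto
  then have "prod_encode (g xs, h xs) = (\<Sum>i<g xs + h xs. Suc i) + g xs" for xs
    by (simp add: prod_encode_def)
  then show ?thesis
    by (simp only:) (intro recursive_add recursive_sum recursive_Suc recursive_hd assms, simp)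
qed

lemma recursive_list_encode_Nil: "recursive k (\<lambda>xs. list_encode [])"
  by (rule recursive_const)

lemma recursive_list_encode_Cons:
  assumes "recursive k g" "recursive k (\<lambda>xs. list_encode (hs xs))"
  shows "recursive k (\<lambda>xs. list_encode (g xs # hs xs))"
  using recursive_Suc[OF recursive_prod_encode[OF assms]] by simp

lemmas recursive_intros = recursive_add recursive_sum recursive_power2 recursive_prod_encode
  recursive_list_encode_Nil recursive_list_encode_Cons recursive_Suc recursive_nth recursive_hd
  recursive_tl_nth recursive_const

section \<open>Loading the input\<close>

text \<open>The two chains count down from node \<open>2 * p + t\<close> to node \<open>p\<close>, where the counters 0 and 1
  hold \<open>p\<close> and \<open>t\<close>.\<close>

definition loader :: "nat \<Rightarrow> nat \<Rightarrow> edge set" where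
  "loader p t = (\<lambda>i. (p + Suc i, Inc 1, p + i)) ` {..<t} \<union>
     (\<lambda>i. (p + t + Suc i, Inc 0, p + t + i)) ` {..<p}"

text \<open>Exactly one edge leaves each chain node above \<open>b\<close>, so the walk down to
  \<open>b\<close> is forced.\<close>

lemma move_chain:
  assumes "\<And>i j q'. i < n \<Longrightarrow> (b + Suc i, j, q') \<in> E \<longleftrightarrow> j = Inc r \<and> q' = b + i" "z \<le> b"
  shows "(move E)\<^sup>*\<^sup>* (b + n, m) (z, m') \<longleftrightarrow> (move E)\<^sup>*\<^sup>* (b, m(r := m r + n)) (z, m')"
  using assms(1)
proof (induction n arbitrary: m)
  case (Suc n)
  have first: "move E (b + Suc n, m) c \<longleftrightarrow> c = (b + n, m(r := Suc (m r)))" for c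
    using Suc.prems[of n] by (cases c) (auto simp: move_def)
  have "(move E)\<^sup>*\<^sup>* (b + Suc n, m) (z, m') \<longleftrightarrow> (move E)\<^sup>*\<^sup>* (b + n, m(r := Suc (m r))) (z, m')"
  proof
    assume "(move E)\<^sup>*\<^sup>* (b + Suc n, m) (z, m')"
    \<comment> \<open>Since \<open>z \<le> b\<close>, the walk cannot end where it starts, so it has
      a first move.\<close>
    then show "(move E)\<^sup>*\<^sup>* (b + n, m(r := Suc (m r))) (z, m')"
      using assms(2) first by (cases rule: converse_rtranclpE) auto
  qed (use first in \<open>blast intro: converse_rtranclp_into_rtranclp\<close>)
  also have "\<dots> \<longleftrightarrow> (move E)\<^sup>*\<^sup>* (b, m(r := m r + Suc n)) (z, m')"
  proof -
    have upd: "(m(r := Suc (m r)))(r := (m(r := Suc (m r))) r + n) = m(r := m r + Suc n)" by simp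
    show ?thesis using Suc.IH[of "m(r := Suc (m r))", unfolded upd] Suc.prems by (simp add: fun_upd_def)
  qed
  finally show ?case .
qed simp

text \<open>Edges of \<open>G\<close> start at nodes up to \<open>p\<close> and those of the loader
  above \<open>p\<close>, so both chains are followed undisturbed.\<close>

lemma move_loader:
  assumes "\<And>q i q'. (q, i, q') \<in> G \<Longrightarrow> q \<le> p"
  shows "(move (G \<union> loader p t))\<^sup>*\<^sup>* (p + t + p, \<lambda>_. 0) (0, m) \<longleftrightarrow>
    (move (G \<union> loader p t))\<^sup>*\<^sup>* (p, (\<lambda>_. 0)(0 := p, 1 := t)) (0, m)"
proof -
  have G: "(q, i, q') \<notin> G" if "q > p" for q i q' using assms[of q i q'] that by auto
  have "(move (G \<union> loader p t))\<^sup>*\<^sup>* (p + t + p, \<lambda>_. 0) (0, m) \<longleftrightarrow>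
      (move (G \<union> loader p t))\<^sup>*\<^sup>* (p + t, (\<lambda>_. 0)(0 := p)) (0, m)"
    using G by (subst move_chain[where r = 0]) (auto simp: loader_def)
  also have "\<dots> \<longleftrightarrow> (move (G \<union> loader p t))\<^sup>*\<^sup>* (p, (\<lambda>_. 0)(0 := p, 1 := t)) (0, m)"
    using G by (subst move_chain[where r = 1]) (auto simp: loader_def)
  finally show ?thesis .
qed

text \<open>The number \<open>p\<close> has two roles: it is an input of the program, and it separates the
  nodes of the program from those of the loader and fixes the number of registers. Hence the code of
  the automaton is a function of \<open>p\<close> and of the code \<open>t\<close> of the transitions of the program.\<close>

definition program_automaton :: "'a \<Rightarrow> prog \<Rightarrow> nat \<Rightarrow> nat \<Rightarrow> (nat, nat, 'a) rsa" where
  "program_automaton a P p t =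
     graph_automaton a (Suc (p + t + p)) (p + 2) (graph P p 0 1 \<union> loader p t) (p + t + p)"

primrec prog_regs :: "prog \<Rightarrow> nat set" where
  "prog_regs (Instr i) = instr_regs i"
| "prog_regs (P ;; Q) = prog_regs P \<union> prog_regs Q"
| "prog_regs (Star P) = prog_regs P"

lemma finite_prog_regs: "finite (prog_regs P)"
proof (induction P)
  case (Instr i)
  then show ?case by (cases i) auto
qed auto

lemma graph_regs: "(q, i, q') \<in> graph P a b n \<Longrightarrow> instr_regs i \<subseteq> prog_regs P"
  by (induction P arbitrary: a b n) fastforce+

context
  fixes P :: prog and p :: nat
  assumes width: "width P < p" and regs: "prog_regs P \<subseteq> {..<p + 2}"
begin

text \<open>As \<open>width P < p\<close>, the inner nodes 1 to \<open>width P\<close> lie strictly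
  between the exit 0 and the entry \<open>p\<close>.\<close>

lemma program_edges:
  assumes "(q, i, q') \<in> graph P p 0 1"
  shows "0 < q" "q \<le> p" "q' \<le> p" "instr_regs i \<subseteq> {..<p + 2}"
  using graph_sources[OF assms] graph_targets[OF assms] graph_regs[OF assms] width regs by auto

lemma program_automaton_edges:
  assumes "(q, i, q') \<in> graph P p 0 1 \<union> loader p t"
  shows "q \<le> p + t + p" "q' \<le> p + t + p" "instr_regs i \<subseteq> {..<p + 2}"
  using assms program_edges[of q i q'] width by (auto simp: loader_def)

lemma rsa_wf_program_automaton: "rsa_wf (program_automaton a P p t)"
  unfolding program_automaton_def
  using program_automaton_edges[of _ _ _ t]
  by (intro rsa_wf_graph_automaton) (auto simp: finite_graph loader_def less_Suc_eq_le)

lemma language_program_automaton: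
  assumes "infinite (UNIV :: 'd set)"
  shows "(language (program_automaton a P p t) :: ('a \<times> 'd) list set) \<noteq> {} \<longleftrightarrow>
    (\<exists>m. sem P ((\<lambda>_. 0)(0 := p, 1 := t)) m)"
proof -
  let ?E = "graph P p 0 1 \<union> loader p t" and ?m = "(\<lambda>_. 0)(0 := p, 1 := t)"
  have "(\<exists>m. (move ?E)\<^sup>*\<^sup>* (p, ?m) (0, m)) \<longleftrightarrow> (\<exists>m. sem P ?m m)"
  proof
    assume "\<exists>m. (move ?E)\<^sup>*\<^sup>* (p, ?m) (0, m)"
    then obtain m l where "(move ?E ^^ l) (p, ?m) (0, m)" by (auto dest: rtranclp_imp_relpowp)
    \<comment> \<open>The loader's edges leave only nodes above \<open>p\<close>, so
      \<open>?E\<close> agrees with the program's graph at the entry and the inner nodes; the exit 0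
      is neither.\<close>
    then have "\<exists>m' l'. l' < l \<and> sem P ?m m' \<and> (move ?E ^^ l') (0, m') (0, m)"
      by (rule graph_sound) (use width in \<open>auto simp: loader_def\<close>)
    then show "\<exists>m. sem P ?m m" by blast
  qed (auto intro: graph_complete)
  then show ?thesis
    unfolding program_automaton_def
    using program_automaton_edges(3)[of _ _ _ t] move_loader[of "graph P p 0 1" p t] program_edges(2)
    by (subst language_graph_automaton[OF assms]) blast+
qed

end

section \<open>The code of the automaton\<close>

lemma set_encode_image:
  assumes "finite A" "inj_on h A"
  shows "set_encode (h ` A) = (\<Sum>x\<in>A. 2 ^ h x)"
  using assms by (simp add: set_encode_def sum.reindex)

text \<open>The code of the update of \<open>Inc r\<close> with \<open>p + 2\<close> registers:
  \<open>{Reg s}\<close> has code \<open>2 ^ Suc s\<close>, and \<open>In\<close>, numbered 0, adds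
  1 at register \<open>r\<close>.\<close>

definition inc_code :: "nat \<Rightarrow> nat \<Rightarrow> nat" where
  "inc_code r p =
     (\<Sum>s<p + 2. 2 ^ prod_encode (s, 2 ^ Suc s + (if s = r then 1 else 0)))"

text \<open>The code of an \<open>Inc r\<close> transition from \<open>q\<close> to
  \<open>q'\<close>, where \<open>l\<close> numbers the letter and \<open>2 ^ r\<close> encodes the
  guard \<open>{r}\<close>.\<close>

definition load_code :: "nat \<Rightarrow> nat \<Rightarrow> nat \<Rightarrow> nat \<Rightarrow> nat \<Rightarrow> nat" where
  "load_code l r p q q' = list_encode [q, l, 0, 2 ^ r, 0, 0, inc_code r p, q']"

text \<open>\<open>t\<close> is a summand of the third entry because \<open>set_encode\<close> is
  additive on disjoint sets. The last entry encodes the final set \<open>{0}\<close>.\<close>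

definition program_automaton_code :: "nat \<Rightarrow> nat \<Rightarrow> nat \<Rightarrow> nat" where
  "program_automaton_code l p t = list_encode
     [(\<Sum>i<Suc (p + t + p). 2 ^ i), (\<Sum>i<p + 2. 2 ^ i),
      t + ((\<Sum>i<t. 2 ^ load_code l 1 p (p + Suc i) (p + i)) +
           (\<Sum>i<p. 2 ^ load_code l 0 p (p + t + Suc i) (p + t + i))),
      2 ^ (p + t + p), 1]"

text \<open>The test \<open>s = r\<close> disappears once the summands for registers 0 and 1 are
  split off; the remaining ones have a uniform form.\<close>

lemma recursive_inc_code:
  assumes "recursive k h"
  shows "recursive k (\<lambda>xs. inc_code 0 (h xs))" "recursive k (\<lambda>xs. inc_code 1 (h xs))"
proof -
  have "inc_code 0 p = 2 ^ prod_encode (0, 3) + (2 ^ prod_encode (1, 4) +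
      (\<Sum>s<p. 2 ^ prod_encode (Suc (Suc s), 2 ^ Suc (Suc (Suc s)))))" for p
    by (simp add: inc_code_def sum.lessThan_Suc_shift numeral_3_eq_3 numeral_eq_Suc
        del: sum.lessThan_Suc)
  then show "recursive k (\<lambda>xs. inc_code 0 (h xs))"
    by (simp only:) (intro recursive_intros assms, simp_all)
  have "inc_code 1 p = 2 ^ prod_encode (0, 2) + (2 ^ prod_encode (1, 5) +
      (\<Sum>s<p. 2 ^ prod_encode (Suc (Suc s), 2 ^ Suc (Suc (Suc s)))))" for p
    by (simp add: inc_code_def sum.lessThan_Suc_shift numeral_eq_Suc
        del: sum.lessThan_Suc)
  then show "recursive k (\<lambda>xs. inc_code 1 (h xs))"
    by (simp only:) (intro recursive_intros assms, simp_all)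
qed

lemma recursive_program_automaton_code:
  "recursive 2 (\<lambda>xs. program_automaton_code l (xs ! 0) (xs ! 1))"
  unfolding program_automaton_code_def load_code_def
  by (intro recursive_intros recursive_inc_code; simp)

section \<open>Agreement of the formula with the actual code\<close>

lemma update_code_inc:
  assumes "r < p + 2"
  shows "update_code {..<p + 2} (update (edge_transition a (p + 2) (q, Inc r, q'))) = inc_code r p"
proof -
  have "set_encode (source_code ` update (edge_transition a (p + 2) (q, Inc r, q')) s) =
      2 ^ Suc s + (if s = r then 1 else 0)" if "s < p + 2" for s
    using that by (simp add: edge_transition_def set_encode_def)
  then have "update_code {..<p + 2} (update (edge_transition a (p + 2) (q, Inc r, q'))) =
      set_encode ((\<lambda>s. prod_encode (s, 2 ^ Suc s + (if s = r then 1 else 0))) ` {..<p + 2})"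
    unfolding update_code_def by (intro arg_cong[where f = set_encode] image_cong) auto
  also have "\<dots> = inc_code r p"
    unfolding inc_code_def by (rule set_encode_image) (auto intro: inj_onI)
  finally show ?thesis .
qed

lemma transition_code_inc:
  assumes "r < p + 2"
  shows "transition_code la {..<p + 2} (edge_transition a (p + 2) (q, Inc r, q')) =
    load_code (la a) r p q q'"
  unfolding transition_code_def load_code_def update_code_inc[OF assms]
  by (simp add: edge_transition_def set_encode_def)

text \<open>The source is the first entry of the code. This keeps the codes of program and loader
  transitions apart.\<close>

lemma transition_code_src:
  "transition_code la R (edge_transition a K e) = transition_code la R (edge_transition a K e') \<Longrightarrow>
     fst e = fst e'"
  by (auto simp: transition_code_def edge_transition_def split: prod.splits)

text \<open>The sources lie in three disjoint ranges: up to \<open>p\<close>, from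
  \<open>p + 1\<close> to \<open>p + t\<close>, and beyond \<open>p + t\<close>. So the three sets
  of codes are disjoint and their set codes add up.\<close>

lemma transitions_code_loader:
  assumes "finite G" "\<And>e. e \<in> G \<Longrightarrow> fst e \<le> p"
  shows "set_encode ((transition_code la {..<p + 2} \<circ> edge_transition a (p + 2)) ` (G \<union> loader p t)) =
    set_encode ((transition_code la {..<p + 2} \<circ> edge_transition a (p + 2)) ` G) +
      ((\<Sum>i<t. 2 ^ load_code (la a) 1 p (p + Suc i) (p + i)) +
       (\<Sum>i<p. 2 ^ load_code (la a) 0 p (p + t + Suc i) (p + t + i)))"
proof -
  define tc where "tc = transition_code la {..<p + 2} \<circ> edge_transition a (p + 2)"
  have src: "fst e = fst e'" if "tc e = tc e'" for e e'
    using that transition_code_src[of la "{..<p + 2}" a "p + 2" e e'] by (simp add: tc_def)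
  define L1 where "L1 = (\<lambda>i. (p + Suc i, Inc 1, p + i)) ` {..<t}"
  define L0 where "L0 = (\<lambda>i. (p + t + Suc i, Inc 0, p + t + i)) ` {..<p}"
  have un: "set_encode (A \<union> B) = set_encode A + set_encode B"
    if "finite A" "finite B" "A \<inter> B = {}" for A B
    using that by (simp add: set_encode_def sum.union_disjoint)
  have fin: "finite (tc ` G)" "finite (tc ` L1)" "finite (tc ` L0)"
    using assms(1) by (simp_all add: L1_def L0_def)
  have "fst ` G \<inter> fst ` L1 = {}" "fst ` G \<inter> fst ` L0 = {}" "fst ` L1 \<inter> fst ` L0 = {}"
    using assms(2) by (auto simp: L1_def L0_def) force+
  moreover have "tc ` A \<inter> tc ` B = {}" if "fst ` A \<inter> fst ` B = {}" for A B
  proof -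
    have "tc e \<noteq> tc e'" if "e \<in> A" "e' \<in> B" for e e'
      using src[of e e'] that \<open>fst ` A \<inter> fst ` B = {}\<close> by (metis disjoint_iff imageI)
    then show ?thesis by auto
  qed
  ultimately have disj: "tc ` G \<inter> (tc ` L1 \<union> tc ` L0) = {}" "tc ` L1 \<inter> tc ` L0 = {}"
    by (simp_all add: Int_Un_distrib)
  have "tc ` (G \<union> loader p t) = tc ` G \<union> (tc ` L1 \<union> tc ` L0)"
    unfolding loader_def L0_def L1_def by (simp only: image_Un)
  then have "set_encode (tc ` (G \<union> loader p t)) =
      set_encode (tc ` G) + (set_encode (tc ` L1) + set_encode (tc ` L0))"
    using un[OF fin(1) _ disj(1)] un[OF fin(2,3) disj(2)] fin by simp
  moreover have "set_encode (tc ` L1) = (\<Sum>i<t. 2 ^ load_code (la a) 1 p (p + Suc i) (p + i))"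
  proof -
    have "tc ` L1 = (\<lambda>i. load_code (la a) 1 p (p + Suc i) (p + i)) ` {..<t}"
      unfolding L1_def image_image tc_def o_def
      by (intro image_cong refl transition_code_inc) simp
    then show ?thesis
      by (simp only:) (rule set_encode_image, auto intro!: inj_onI simp: load_code_def)
  qed
  moreover have "set_encode (tc ` L0) = (\<Sum>i<p. 2 ^ load_code (la a) 0 p (p + t + Suc i) (p + t + i))"
  proof -
    have "tc ` L0 = (\<lambda>i. load_code (la a) 0 p (p + t + Suc i) (p + t + i)) ` {..<p}"
      unfolding L0_def image_image tc_def o_def
      by (intro image_cong refl transition_code_inc) simp
    then show ?thesis
      by (simp only:) (rule set_encode_image, auto intro!: inj_onI simp: load_code_def)
  qed
  ultimately show ?thesis unfolding tc_def by simp
qed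

text \<open>The equation for \<open>t\<close> is not circular: the codes of the program's
  transitions depend on \<open>p\<close>, through the registers and the entry node, but not on the
  loader or the number of states.\<close>

lemma rsa_code_program_automaton:
  assumes "width P < p" "prog_regs P \<subseteq> {..<p + 2}"
    and "t = set_encode ((transition_code la {..<p + 2} \<circ> edge_transition a (p + 2)) ` graph P p 0 1)"
  shows "rsa_code la (program_automaton a P p t) = program_automaton_code (la a) p t"
proof -
  have "fst e \<le> p" if "e \<in> graph P p 0 1" for e
    using that program_edges(2)[OF assms(1,2)] by (cases e) auto
  note transitions_code_loader[of "graph P p 0 1" p la a t, OF finite_graph this]
  moreover have "set_encode {..<n} = (\<Sum>i<n. 2 ^ i)" "set_encode {n} = 2 ^ n" for n
    by (simp_all add: set_encode_def)
  ultimately show ?thesis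
    unfolding rsa_code_def program_automaton_def graph_automaton_def program_automaton_code_def
    by (simp only: rsa.simps image_comp power_0 assms(3)[symmetric])
qed

section \<open>Undecidability\<close>

theorem theorem7p3:
  fixes la :: "'a::finite \<Rightarrow> nat"
  assumes "inj la"
    and "infinite (UNIV :: 'd set)"
  shows "\<not> decidable (rsa_code la) {A. rsa_wf A} (\<lambda>A. (language A :: ('a \<times> 'd) list set) = {})"
proof
  assume "decidable (rsa_code la) {A. rsa_wf A} (\<lambda>A. (language A :: ('a \<times> 'd) list set) = {})"
  then obtain D where D: "\<And>A. rsa_wf A \<Longrightarrow>
      eval D [rsa_code la A] = Some (if (language A :: ('a \<times> 'd) list set) = {} then 1 else 0)"
    unfolding decidable_def by blast
  fix a :: 'a
  obtain g where "\<And>xs. length xs = 2 \<Longrightarrow>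
      eval g xs = Some (program_automaton_code (la a) (xs ! 0) (xs ! 1))"
    using recursive_program_automaton_code unfolding recursive_def by blast
  then have g: "eval g [p, t] = Some (program_automaton_code (la a) p t)" for p t
    by simp
  \<comment> \<open>The result of \<open>D\<close> is left in register 2; decrementing and then
    testing for zero succeeds exactly on 1.\<close>
  define P where "P = compile (Comp D [g]) [0, 1] 2 ;; Instr (Dec 2) ;; Instr (IfZero 2)"
  obtain n where "prog_regs P \<subseteq> {..<n}"
    using finite_prog_regs[of P] by (auto simp: finite_nat_set_iff_bounded)
  \<comment> \<open>\<open>P\<close> reads \<open>p\<close> and \<open>t\<close> from its registers
    and is fixed before them, so \<open>p\<close> can be chosen to bound the size of
    \<open>P\<close> itself.\<close>
  then obtain p where p: "width P < p" "prog_regs P \<subseteq> {..<p + 2}"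
    by (intro that[of "Suc (width P + n)"]) auto
  define t where
    "t = set_encode ((transition_code la {..<p + 2} \<circ> edge_transition a (p + 2)) ` graph P p 0 1)"
  let ?A = "program_automaton a P p t" and ?m = "(\<lambda>_. 0)(0 := p, 1 := t) :: nat \<Rightarrow> nat"
  have code: "eval g [p, t] = Some (rsa_code la ?A)"
    using g rsa_code_program_automaton[OF p t_def] by simp
  have sub: "set [0, 1] \<subseteq> {..<2 :: nat}" and args: "map ?m [0, 1] = [p, t]" by auto
  have "(\<exists>m. sem P ?m m) \<longleftrightarrow> eval (Comp D [g]) [p, t] = Some 1"
  proof
    assume "\<exists>m. sem P ?m m"
    then obtain m where "sem (compile (Comp D [g]) [0, 1] 2) ?m m" "m 2 = 1"
      unfolding P_def by (auto simp: relcompp_apply simp del: compile.simps)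
    then show "eval (Comp D [g]) [p, t] = Some 1"
      using computes_sound(1)[OF compile_computes _ sub, of "Comp D [g]" ?m m] unfolding args by simp
  next
    assume "eval (Comp D [g]) [p, t] = Some 1"
    then obtain m where "sem (compile (Comp D [g]) [0, 1] 2) ?m m" "m 2 = 1"
      using computes_complete[OF compile_computes _ sub, of "Comp D [g]" ?m 1] unfolding args by blast
    then show "\<exists>m. sem P ?m m"
      unfolding P_def by (auto simp: relcompp_apply simp del: compile.simps)
  qed
  also have "\<dots> \<longleftrightarrow> (language ?A :: ('a \<times> 'd) list set) = {}"
    using code D[OF rsa_wf_program_automaton[OF p]] by simp
  \<comment> \<open>\<open>P\<close> has an outcome on \<open>p\<close> and \<open>t\<close> iff the
    language is empty, but also iff it is nonempty.\<close>
  finally show False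
    using language_program_automaton[OF p assms(2), of a t] by simp
qed

end
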